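(* Let $a,b,c$ be positive integers and let $G=B(1,a,b,c)$. Then, with $m=\binom{b+1}{2}+\binom{c+1}{2}+a-1$, \begin{align*}\mathscr{K}(G)=\frac1m\Big[&\tbinom{b+1}{2}\Big(\tfrac{b^2}{b+1}+(a-1)^2+\tfrac{2c^2}{c+1}\Big)+(a-1)\Big(\tfrac{2a^2-4a+3}{6}+\tfrac{2b^2}{b+1}+\tfrac{2c^2}{c+1}\Big)\\&+\tbinom{c+1}{2}\Big(\tfrac{c^2}{c+1}+(a-1)^2+\tfrac{2b^2}{b+1}\Big)+2\tbinom{b+1}{2}\tbinom{c+1}{2}(a-1)\Big].\end{align*}
   Context: The barbell graph $B(1,a,b,c)$ on $a+b+c$ vertices is obtained from a path $P_a$ on $a$ vertices by joining every vertex of a complete graph $K_b$ to one endpoint of the path (forming a clique $K_{b+1}$ with that endpoint) and joining every vertex of a complete graph $K_c$ to the other endpoint (forming a clique $K_{c+1}$); equivalently it is the 1-sum of $K_{b+1}$, $P_a$, $K_{c+1}$ glued at the endpoints of the path. It has $\binom{b+1}{2}+\binom{c+1}{2}+a-1$ edges. For a connected graph $H$ with $m\ge1$ edges and degrees $d_i$, Kemeny's constant is $\mathscr{K}(H)=\sum_j\pi_jm_{ij}$ for the simple random walk on $H$, where $\pi_j=d_j/2m$ and $m_{ij}$ is the expected hitting time of $j$ starting from $i$ (with $m_{jj}=0$); equivalently $\mathscr{K}(H)=\frac1{4m}\sum_{i,j}d_id_jr_H(i,j)$ with $r_H$ the effective resistance (unit resistor on each edge). *)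

theory Defs
  imports "HOL-Probability.Probability"
begin

text \<open>A finite simple graph is given by its vertex set \<open>V\<close> and its set \<open>E\<close> of edges, each edge being
  a two-element subset of \<open>V\<close>.\<close>

definition neighbours :: "'a set set \<Rightarrow> 'a \<Rightarrow> 'a set" where
  "neighbours E v = {w. {v, w} \<in> E}"

definition vdegree :: "'a set set \<Rightarrow> 'a \<Rightarrow> nat" where
  "vdegree E v = card (neighbours E v)"

text \<open>The simple random walk in its random mapping representation: the sample space consists of
  i.i.d. sequences of maps \<open>f\<^sub>0, f\<^sub>1, \<dots>\<close>, where each \<open>f\<^sub>n\<close> sends every vertex to an independently and
  uniformly chosen neighbour, and the walk started at \<open>i\<close> is \<open>X\<^sub>0 = i\<close>, \<open>X\<^sub>n\<^sub>+\<^sub>1 = f\<^sub>n X\<^sub>n\<close>.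
  That this has the transition probabilities of the simple random walk is \<open>emeasure_walk_eq\<close> below.\<close>

definition random_move :: "'a set \<Rightarrow> 'a set set \<Rightarrow> ('a \<Rightarrow> 'a) pmf" where
  "random_move V E = Pi_pmf V undefined (\<lambda>v. pmf_of_set (neighbours E v))"

definition walk_space :: "'a set \<Rightarrow> 'a set set \<Rightarrow> ('a \<Rightarrow> 'a) stream measure" where
  "walk_space V E = stream_space (measure_pmf (random_move V E))"

primrec walk :: "'a \<Rightarrow> ('a \<Rightarrow> 'a) stream \<Rightarrow> nat \<Rightarrow> 'a" where
  "walk i \<omega> 0 = i"
| "walk i \<omega> (Suc n) = (\<omega> !! n) (walk i \<omega> n)"

definition hitting_time :: "'a \<Rightarrow> 'a \<Rightarrow> ('a \<Rightarrow> 'a) stream \<Rightarrow> ennreal" where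
  "hitting_time i j \<omega> =
     (if \<exists>n. walk i \<omega> n = j then of_nat (LEAST n. walk i \<omega> n = j) else \<infinity>)"

text \<open>Countability of the vertex type makes the hitting times measurable.\<close>

definition mean_hitting_time :: "'a::countable set \<Rightarrow> 'a set set \<Rightarrow> 'a \<Rightarrow> 'a \<Rightarrow> ennreal" where
  "mean_hitting_time V E i j = (\<integral>\<^sup>+\<omega>. hitting_time i j \<omega> \<partial>walk_space V E)"

definition stationary :: "'a set set \<Rightarrow> 'a \<Rightarrow> real" where
  "stationary E j = real (vdegree E j) / (2 * real (card E))"

text \<open>Kemeny's constant of a connected graph with at least one edge. The sum is independent of the
  starting vertex \<open>i \<in> V\<close>, but since this is a theorem, \<open>i\<close> is kept as an argument.\<close>

definition kemeny :: "'a::countable set \<Rightarrow> 'a set set \<Rightarrow> 'a \<Rightarrow> ennreal" where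
  "kemeny V E i = (\<Sum>j\<in>V. ennreal (stationary E j) * mean_hitting_time V E i j)"

datatype barbell_vertex = PathV nat | LeftV nat | RightV nat

instance barbell_vertex :: countable
  by countable_datatype

definition clique_edges :: "'a set \<Rightarrow> 'a set set" where
  "clique_edges S = {{u, v} | u v. u \<in> S \<and> v \<in> S \<and> u \<noteq> v}"

definition barbell_verts :: "nat \<Rightarrow> nat \<Rightarrow> nat \<Rightarrow> barbell_vertex set" where
  "barbell_verts a b c = PathV ` {1..a} \<union> LeftV ` {1..b} \<union> RightV ` {1..c}"

text \<open>The graph \<open>B(1,a,b,c)\<close>: the path \<open>PathV 1, \<dots>, PathV a\<close> with a clique \<open>K\<^sub>b\<close> joined to \<open>PathV 1\<close>
  and a clique \<open>K\<^sub>c\<close> joined to \<open>PathV a\<close> (the same vertex if \<open>a = 1\<close>).\<close>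

definition barbell_edges :: "nat \<Rightarrow> nat \<Rightarrow> nat \<Rightarrow> barbell_vertex set set" where
  "barbell_edges a b c =
     {{PathV k, PathV (Suc k)} | k. 1 \<le> k \<and> k < a} \<union>
     clique_edges (insert (PathV 1) (LeftV ` {1..b})) \<union>
     clique_edges (insert (PathV a) (RightV ` {1..c}))"

lemma walk_SCons: "walk i (f ## \<omega>) (Suc n) = walk (f i) \<omega> n"
  by (induction n) auto

lemma measurable_walk [measurable]:
  fixes i :: "'a::countable"
  shows "(\<lambda>\<omega>. walk i \<omega> n) \<in> measurable (walk_space V E) (count_space UNIV)"
proof (induction n)
  case (Suc n)
  note [measurable] = Suc
  have [measurable]: "(\<lambda>\<omega>. (\<omega> !! n) v) \<in> measurable (walk_space V E) (count_space UNIV)" for v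
    unfolding walk_space_def
    by (rule measurable_compose[OF measurable_snth]) simp
  have "(\<lambda>\<omega>. (\<lambda>v. (\<omega> !! n) v) (walk i \<omega> n)) \<in> measurable (walk_space V E) (count_space UNIV)"
    by (rule measurable_compose_countable[where g = "\<lambda>\<omega>. walk i \<omega> n"]) measurable
  then show ?case by simp
qed simp

lemma emeasure_walk_eq:
  fixes x :: "nat \<Rightarrow> 'a::countable"
  assumes "finite V" "\<And>e. e \<in> E \<Longrightarrow> e \<subseteq> V" "\<And>v. v \<in> V \<Longrightarrow> neighbours E v \<noteq> {}" "i \<in> V"
  shows "emeasure (walk_space V E) {\<omega> \<in> space (walk_space V E). \<forall>k\<le>n. walk i \<omega> k = x k} =
    (if x 0 = i then ennreal (\<Prod>k<n. if {x k, x (Suc k)} \<in> E then 1 / vdegree E (x k) else 0) else 0)"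
  using assms(4)
proof (induction n arbitrary: i x)
  case 0
  interpret prob_space "walk_space V E"
    unfolding walk_space_def by (rule prob_space.prob_space_stream_space[OF prob_space_measure_pmf])
  show ?case by (auto simp: emeasure_space_1)
next
  case (Suc n)
  let ?S = "walk_space V E" and ?M = "measure_pmf (random_move V E)"
  let ?A = "{\<omega> \<in> space ?S. \<forall>k\<le>Suc n. walk i \<omega> k = x k}"
  let ?B = "{\<omega> \<in> space ?S. \<forall>k\<le>n. walk (x 1) \<omega> k = x (Suc k)}"
  let ?p = "\<lambda>k. if {x k, x (Suc k)} \<in> E then 1 / real (vdegree E (x k)) else 0"
  show ?case
  proof (cases "x 0 = i")
    case False
    then have A: "?A = {}" by auto
    show ?thesis unfolding A using False by simp
  next
    case True
    have spc: "space ?S = UNIV"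
      by (simp add: walk_space_def space_stream_space)
    have all: "(\<forall>k\<le>Suc n. P k) \<longleftrightarrow> P 0 \<and> (\<forall>k\<le>n. P (Suc k))" for P
      by (metis Suc_le_mono le0 not0_implies_Suc)
    have A: "?A \<in> sets ?S" by measurable
    have slice: "{\<omega> \<in> space ?S. f ## \<omega> \<in> ?A} = (if f i = x 1 then ?B else {})" for f
    proof (cases "f i = x 1")
      case True
      then show ?thesis
        using \<open>x 0 = i\<close> by (auto simp: spc all walk_SCons simp del: walk.simps(2))
    next
      case False
      have "f ## \<omega> \<notin> ?A" for \<omega>
      proof
        assume "f ## \<omega> \<in> ?A"
        then have "\<forall>k\<le>Suc n. walk i (f ## \<omega>) k = x k" by simp
        from this[rule_format, of 1] have "walk i (f ## \<omega>) 1 = x 1" by simp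
        with False show False by simp
      qed
      with False show ?thesis by simp
    qed
    have nb: "finite (neighbours E i)" "neighbours E i \<noteq> {}"
      using assms(1-3) Suc.prems
      by (auto simp: neighbours_def intro!: finite_subset[OF _ assms(1)])
    have "emeasure ?S ?A = (\<integral>\<^sup>+f. emeasure ?S {\<omega> \<in> space ?S. f ## \<omega> \<in> ?A} \<partial>?M)"
      using A unfolding walk_space_def
      by (rule prob_space.emeasure_stream_space[OF prob_space_measure_pmf])
    also have "\<dots> = (\<integral>\<^sup>+f. emeasure ?S ?B * indicator {f. f i = x 1} f \<partial>?M)"
      by (rule nn_integral_cong, subst slice) (simp add: indicator_def)
    also have "\<dots> = emeasure ?S ?B * emeasure ?M {f. f i = x 1}"
      by (subst nn_integral_cmult_indicator) auto
    also have "emeasure ?M {f. f i = x 1} = ennreal (pmf (map_pmf (\<lambda>f. f i) (random_move V E)) (x 1))"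
      by (simp add: pmf_map measure_pmf.emeasure_eq_measure vimage_def)
    also have "map_pmf (\<lambda>f. f i) (random_move V E) = pmf_of_set (neighbours E i)"
      using Suc.prems assms(1) by (simp add: random_move_def Pi_pmf_component)
    also have "pmf (pmf_of_set (neighbours E i)) (x 1) = ?p 0"
      using nb True by (auto simp: vdegree_def neighbours_def indicator_def)
    also have "emeasure ?S ?B * ennreal (?p 0) = ennreal (\<Prod>k<Suc n. ?p k)"
    proof (cases "{x 0, x 1} \<in> E")
      case True
      then have "x 1 \<in> V" using assms(2) by blast
      have "emeasure ?S ?B = ennreal (\<Prod>k<n. ?p (Suc k))"
        using Suc.IH[OF \<open>x 1 \<in> V\<close>, of "\<lambda>k. x (Suc k)"] by simp
      moreover have "(\<Prod>k<Suc n. ?p k) = ?p 0 * (\<Prod>k<n. ?p (Suc k))"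
        by (rule prod.lessThan_Suc_shift)
      moreover have "0 \<le> ?p 0" "0 \<le> (\<Prod>k<n. ?p (Suc k))"
        by (auto intro!: prod_nonneg)
      ultimately show ?thesis
        by (simp only: ennreal_mult mult.commute)
    next
      case False
      then have z: "(\<Prod>k<Suc n. ?p k) = 0"
        by (subst prod.lessThan_Suc_shift) simp
      show ?thesis unfolding z using False by simp
    qed
    finally show ?thesis by (simp only: True if_True simp_thms)
  qed
qed

end

theory Submission
  imports Defs
begin

text \<open>Suppose that \<open>r\<close> is symmetric, vanishes on the diagonal, and that its Laplacian in the first
  argument is \<open>g x - 2\<cdot>[x = y]\<close> with \<open>g\<close> independent of \<open>y\<close>, as is the case for effective
  resistance. Then \<open>h\<^sub>j x = \<Sum>\<^sub>z d\<^sub>z (r x j + r j z - r x z) / 2\<close> solves the one-step equations for the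
  mean hitting time of \<open>j\<close>. Bounded solutions of these equations are unique, so weighting with the
  stationary distribution, where two of the three terms cancel, gives Kemeny's constant as
  \<open>(\<Sum>\<^sub>x\<^sub>,\<^sub>y d\<^sub>x d\<^sub>y r x y) / 4m\<close>. The barbell graph is a 1-sum, so its resistances add along the path,
  with resistance \<open>2 / (b + 1)\<close> between distinct vertices of the clique \<open>K\<^sub>b\<^sub>+\<^sub>1\<close>. What remains is to
  sum quadratic polynomials over the path.\<close>

section \<open>Hitting times and resistances\<close>

text \<open>For a start \<open>v\<close> in \<open>V\<close> this is the probability that the walk
  avoids \<open>j\<close> at all times from 0 to \<open>n\<close> inclusive, given by its first-step
  recursion. Time 0 counts, hence the value 0 at \<open>v = j\<close> already for
  \<open>n = 0\<close>.\<close>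

primrec survival :: "'a set set \<Rightarrow> 'a \<Rightarrow> nat \<Rightarrow> 'a \<Rightarrow> real" where
  "survival E j 0 v = (if v = j then 0 else 1)"
| "survival E j (Suc n) v =
     (if v = j then 0 else (\<Sum>w\<in>neighbours E v. survival E j n w) / real (vdegree E v))"

lemma survival_nonneg: "0 \<le> survival E j n v"
  by (induction n arbitrary: v) (auto intro!: divide_nonneg_nonneg sum_nonneg)

text \<open>The tail-sum formula holds pointwise: the indicators are 1 exactly at the times before
  the first visit. If \<open>j\<close> is never visited, both sides are infinite.\<close>

lemma hitting_time_eq_suminf:
  "hitting_time i j \<omega> = (\<Sum>n. indicator {\<omega>. \<forall>k\<le>n. walk i \<omega> k \<noteq> j} \<omega>)"
proof (cases "\<exists>n. walk i \<omega> n = j")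
  case True
  define N where "N = (LEAST n. walk i \<omega> n = j)"
  have N: "walk i \<omega> N = j"
    unfolding N_def using True by (rule LeastI_ex)
  have less: "walk i \<omega> k \<noteq> j" if "k < N" for k
    using that not_less_Least unfolding N_def by blast
  have "(\<forall>k\<le>n. walk i \<omega> k \<noteq> j) \<longleftrightarrow> n < N" for n
    using N less by (metis le_less_trans not_less)
  then have "(\<Sum>n. indicator {\<omega>. \<forall>k\<le>n. walk i \<omega> k \<noteq> j} \<omega>) = (\<Sum>n<N. 1 :: ennreal)"
    by (subst suminf_finite[of "{..<N}"]) (auto simp: indicator_def)
  with True show ?thesis
    by (simp add: hitting_time_def N_def)
next
  case False
  then have "(\<Sum>n. indicator {\<omega>. \<forall>k\<le>n. walk i \<omega> k \<noteq> j} \<omega>) = (\<Sum>n::nat. 1 :: ennreal)"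
    by (simp add: indicator_def)
  also have "\<dots> = \<infinity>"
    by (subst nn_integral_count_space_nat[symmetric]) simp
  finally show ?thesis
    using False by (simp add: hitting_time_def)
qed

section \<open>First-step analysis of the walk on a finite graph\<close>

locale walkable_graph =
  fixes V :: "'a::countable set" and E :: "'a set set"
  assumes finite_verts: "finite V"
    and edge_subset: "e \<in> E \<Longrightarrow> e \<subseteq> V"
    and neighbours_nonempty: "v \<in> V \<Longrightarrow> neighbours E v \<noteq> {}"
begin

lemma neighbours_subset: "neighbours E v \<subseteq> V"
  using edge_subset by (auto simp: neighbours_def)

lemma finite_neighbours: "finite (neighbours E v)"
  using neighbours_subset finite_verts by (rule finite_subset)

lemma vdegree_pos: "v \<in> V \<Longrightarrow> 0 < vdegree E v"
  using finite_neighbours neighbours_nonempty by (simp add: vdegree_def card_gt_0_iff)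

text \<open>This is the Markov property at time 1: given the first map \<open>f\<close>, the rest of
  the stream is a fresh copy driving a walk from \<open>f i\<close>.\<close>

lemma emeasure_not_hit:
  assumes "i \<in> V"
  shows "emeasure (walk_space V E) {\<omega> \<in> space (walk_space V E). \<forall>k\<le>n. walk i \<omega> k \<noteq> j} =
    ennreal (survival E j n i)"
  using assms
proof (induction n arbitrary: i)
  case 0
  interpret prob_space "walk_space V E"
    unfolding walk_space_def by (rule prob_space.prob_space_stream_space[OF prob_space_measure_pmf])
  show ?case by (auto simp: emeasure_space_1)
next
  case (Suc n)
  let ?S = "walk_space V E" and ?M = "measure_pmf (random_move V E)"
  let ?A = "\<lambda>n i. {\<omega> \<in> space ?S. \<forall>k\<le>n. walk i \<omega> k \<noteq> j}"
  show ?case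
  proof (cases "i = j")
    case True
    then have "?A (Suc n) i = {}" by auto
    with True show ?thesis by (simp only: survival.simps) simp
  next
    case False
    have spc: "space ?S = UNIV"
      by (simp add: walk_space_def space_stream_space)
    have all: "(\<forall>k\<le>Suc n. P k) \<longleftrightarrow> P 0 \<and> (\<forall>k\<le>n. P (Suc k))" for P
      by (metis Suc_le_mono le0 not0_implies_Suc)
    have A: "?A (Suc n) i \<in> sets ?S" by measurable
    \<comment> \<open>Since \<open>i\<close> differs from \<open>j\<close>, the condition at time 0
      holds, and dropping \<open>f\<close> shifts the remaining times down by one.\<close>
    have slice: "{\<omega> \<in> space ?S. f ## \<omega> \<in> ?A (Suc n) i} = ?A n (f i)" for f
      using False by (auto simp: spc all walk_SCons simp del: walk.simps(2))
    have "emeasure ?S (?A (Suc n) i) =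
        (\<integral>\<^sup>+f. emeasure ?S {\<omega> \<in> space ?S. f ## \<omega> \<in> ?A (Suc n) i} \<partial>?M)"
      using A unfolding walk_space_def
      by (rule prob_space.emeasure_stream_space[OF prob_space_measure_pmf])
    also have "\<dots> = (\<integral>\<^sup>+f. emeasure ?S (?A n (f i)) \<partial>?M)"
      by (simp only: slice)
    also have "\<dots> = (\<integral>\<^sup>+v. emeasure ?S (?A n v) \<partial>measure_pmf (map_pmf (\<lambda>f. f i) (random_move V E)))"
      by simp
    \<comment> \<open>Only the coordinate of the random map at \<open>i\<close> matters, and its
      marginal is uniform on the neighbours.\<close>
    also have "map_pmf (\<lambda>f. f i) (random_move V E) = pmf_of_set (neighbours E i)"
      using Suc.prems finite_verts by (simp add: random_move_def Pi_pmf_component)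
    also have "(\<integral>\<^sup>+v. emeasure ?S (?A n v) \<partial>measure_pmf (pmf_of_set (neighbours E i))) =
        (\<Sum>v\<in>neighbours E i. emeasure ?S (?A n v)) / real (vdegree E i)"
      using finite_neighbours neighbours_nonempty[OF Suc.prems]
      by (simp add: nn_integral_pmf_of_set vdegree_def ennreal_of_nat_eq_real_of_nat)
    also have "(\<Sum>v\<in>neighbours E i. emeasure ?S (?A n v)) =
        (\<Sum>v\<in>neighbours E i. ennreal (survival E j n v))"
      using neighbours_subset Suc.IH by (intro sum.cong) auto
    also have "\<dots> = ennreal (\<Sum>v\<in>neighbours E i. survival E j n v)"
      by (simp add: sum_ennreal survival_nonneg)
    also have "\<dots> / real (vdegree E i) = ennreal (survival E j (Suc n) i)"
      using False vdegree_pos[OF Suc.prems]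
      by (simp add: divide_ennreal sum_nonneg survival_nonneg)
    finally show ?thesis .
  qed
qed

text \<open>The tail-sum formula has nonnegative terms and can be integrated term by term, whether
  or not the mean is finite.\<close>

lemma mean_hitting_time_eq_suminf:
  assumes "i \<in> V"
  shows "mean_hitting_time V E i j = (\<Sum>n. ennreal (survival E j n i))"
proof -
  let ?S = "walk_space V E"
  let ?A = "\<lambda>n. {\<omega> \<in> space ?S. \<forall>k\<le>n. walk i \<omega> k \<noteq> j}"
  have [measurable]: "?A n \<in> sets ?S" for n by measurable
  have "mean_hitting_time V E i j = (\<integral>\<^sup>+\<omega>. (\<Sum>n. indicator (?A n) \<omega>) \<partial>?S)"
    unfolding mean_hitting_time_def hitting_time_eq_suminf
    by (intro nn_integral_cong suminf_cong) (auto simp: indicator_def)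
  also have "\<dots> = (\<Sum>n. emeasure ?S (?A n))"
    by (subst nn_integral_suminf) auto
  also have "\<dots> = (\<Sum>n. ennreal (survival E j n i))"
    by (simp only: emeasure_not_hit[OF assms])
  finally show ?thesis .
qed

text \<open>The remainder of the iterated one-step equation for \<open>h\<close> is at most a constant times the
  survival probability, so boundedness of \<open>h\<close> makes the survival probabilities summable, and
  hence makes the remainder vanish.\<close>

lemma mean_hitting_time_eqI:
  fixes h :: "'a \<Rightarrow> real"
  assumes hj: "h j = 0"
    and laplace: "\<And>v. v \<in> V \<Longrightarrow> v \<noteq> j \<Longrightarrow> (\<Sum>w\<in>neighbours E v. h v - h w) = real (vdegree E v)"
    and i: "i \<in> V"
  shows "mean_hitting_time V E i j = ennreal (h i)" and "0 \<le> h i"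
proof -
  define C where "C = (\<Sum>v\<in>V. \<bar>h v\<bar>)"
  have C: "\<bar>h v\<bar> \<le> C" if "v \<in> V" for v
    unfolding C_def using that finite_verts by (intro member_le_sum) auto
  have rem: "\<bar>h v - (\<Sum>k<n. survival E j k v)\<bar> \<le> C * survival E j n v" if "v \<in> V" for n v
    using that
  proof (induction n arbitrary: v)
    case 0
    then show ?case using C hj by auto
  next
    case (Suc n)
    show ?case
    proof (cases "v = j")
      case True
      have "survival E j k j = 0" for k by (cases k) auto
      with True hj show ?thesis by (simp del: survival.simps)
    next
      case False
      let ?d = "real (vdegree E v)" and ?N = "neighbours E v"
      have d: "?d > 0" using vdegree_pos[OF Suc.prems] by simp
      have "(\<Sum>w\<in>?N. h v - h w) = ?d * h v - (\<Sum>w\<in>?N. h w)"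
        by (simp add: sum_subtractf vdegree_def)
      with laplace[OF Suc.prems False] have h: "h v = 1 + (\<Sum>w\<in>?N. h w) / ?d"
        using d by (simp add: field_simps)
      \<comment> \<open>The term \<open>k = 0\<close> is 1 because \<open>v\<close> differs from
        \<open>j\<close>; every later term is an average over the neighbours. The partial sums thus
        obey the same recursion as \<open>h\<close>, and the 1 cancels in the difference.\<close>
      have "(\<Sum>k<Suc n. survival E j k v) = 1 + (\<Sum>k<n. (\<Sum>w\<in>?N. survival E j k w) / ?d)"
        using False by (subst sum.lessThan_Suc_shift) simp
      also have "\<dots> = 1 + (\<Sum>w\<in>?N. \<Sum>k<n. survival E j k w) / ?d"
        by (subst sum.swap) (simp add: sum_divide_distrib)
      finally have "h v - (\<Sum>k<Suc n. survival E j k v) =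
          (\<Sum>w\<in>?N. h w - (\<Sum>k<n. survival E j k w)) / ?d"
        using h by (simp add: sum_subtractf diff_divide_distrib)
      also have "\<bar>\<dots>\<bar> = \<bar>\<Sum>w\<in>?N. h w - (\<Sum>k<n. survival E j k w)\<bar> / ?d"
        using d by simp
      also have "\<dots> \<le> (\<Sum>w\<in>?N. C * survival E j n w) / ?d"
      proof (rule divide_right_mono)
        have "\<bar>\<Sum>w\<in>?N. h w - (\<Sum>k<n. survival E j k w)\<bar> \<le>
            (\<Sum>w\<in>?N. \<bar>h w - (\<Sum>k<n. survival E j k w)\<bar>)"
          by (rule sum_abs)
        also have "\<dots> \<le> (\<Sum>w\<in>?N. C * survival E j n w)"
          using Suc.IH neighbours_subset by (intro sum_mono) auto
        finally show "\<bar>\<Sum>w\<in>?N. h w - (\<Sum>k<n. survival E j k w)\<bar> \<le> \<dots>" .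
      qed (use d in simp)
      also have "\<dots> = C * survival E j (Suc n) v"
        using False by (simp add: sum_distrib_left)
      finally show ?thesis .
    qed
  qed
  have le1: "survival E j n v \<le> 1" if "v \<in> V" for n v
    using that
  proof (induction n arbitrary: v)
    case (Suc n)
    have "(\<Sum>w\<in>neighbours E v. survival E j n w) \<le> (\<Sum>w\<in>neighbours E v. 1)"
      using Suc.IH neighbours_subset by (intro sum_mono) auto
    then show ?case
      using vdegree_pos[OF Suc.prems] by (simp add: vdegree_def)
  qed simp
  have "C \<ge> 0" unfolding C_def by (simp add: sum_nonneg)
  \<comment> \<open>The bound \<open>rem\<close>, with survival probabilities at most 1, keeps the
    partial sums within \<open>C\<close> of \<open>h i\<close>.\<close>
  have "summable (\<lambda>n. survival E j n i)"
  proof (rule summableI_nonneg_bounded)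
    show "(\<Sum>k<n. survival E j k i) \<le> h i + C" for n
    proof -
      have "C * survival E j n i \<le> C * 1"
        using le1[OF i] \<open>C \<ge> 0\<close> by (rule mult_left_mono)
      with rem[OF i, of n] show ?thesis by linarith
    qed
  qed (rule survival_nonneg)
  then have "(\<lambda>n. C * survival E j n i) \<longlonglongrightarrow> 0"
    by (intro tendsto_mult_right_zero summable_LIMSEQ_zero)
  then have "(\<lambda>n. h i - (\<Sum>k<n. survival E j k i)) \<longlonglongrightarrow> 0"
    by (rule Lim_null_comparison[rotated]) (use rem[OF i] in simp)
  then have "(\<lambda>n. h i - (h i - (\<Sum>k<n. survival E j k i))) \<longlonglongrightarrow> h i - 0"
    by (intro tendsto_diff tendsto_const)
  then have sums: "(\<lambda>n. survival E j n i) sums h i"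
    by (simp add: sums_def)
  then show "0 \<le> h i"
    using survival_nonneg by (rule sums_le[OF _ sums_zero, rotated])
  show "mean_hitting_time V E i j = ennreal (h i)"
    using sums unfolding mean_hitting_time_eq_suminf[OF i]
    by (intro suminf_ennreal_eq survival_nonneg)
qed

text \<open>Effective resistance enters only through these properties of \<open>r\<close>, so an
  explicit candidate merely has to be checked against the Laplacian identity. The value does not
  mention \<open>i\<close>, which shows independence of the starting vertex.\<close>

theorem kemeny_eq_resistance:
  fixes r :: "'a \<Rightarrow> 'a \<Rightarrow> real" and g :: "'a \<Rightarrow> real"
  assumes sym: "\<And>x y. r x y = r y x" and diag: "\<And>x. r x x = 0"
    and laplace: "\<And>x y. x \<in> V \<Longrightarrow> y \<in> V \<Longrightarrow>
      (\<Sum>w\<in>neighbours E x. r x y - r w y) = g x - (if x = y then 2 else 0)"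
    and i: "i \<in> V"
  shows "kemeny V E i = ennreal
    ((\<Sum>x\<in>V. \<Sum>y\<in>V. real (vdegree E x) * real (vdegree E y) * r x y) / (4 * real (card E)))"
proof -
  define d where "d x = real (vdegree E x)" for x
  define m where "m = real (card E)"
  \<comment> \<open>This is Tetali's formula for the mean hitting time of \<open>j\<close> from
    \<open>x\<close> in terms of resistances.\<close>
  define h where "h j x = (\<Sum>z\<in>V. d z * (r x j + r j z - r x z)) / 2" for j x
  have h2: "2 * h j x = (\<Sum>z\<in>V. d z * (r x j + r j z - r x z))" for j x
    by (simp add: h_def)
  have hj: "h j j = 0" for j
    by (simp add: h_def diag)
  have lap: "(\<Sum>w\<in>neighbours E v. h j v - h j w) = real (vdegree E v)"
    if "v \<in> V" "j \<in> V" "v \<noteq> j" for v j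
  proof -
    have "(\<Sum>w\<in>neighbours E v. h j v - h j w) =
        (\<Sum>w\<in>neighbours E v. \<Sum>z\<in>V. d z / 2 * ((r v j - r w j) - (r v z - r w z)))"
      unfolding h_def diff_divide_distrib[symmetric] sum_subtractf[symmetric] sum_divide_distrib
      by (intro sum.cong refl) (simp add: field_simps)
    also have "\<dots> = (\<Sum>z\<in>V. \<Sum>w\<in>neighbours E v. d z / 2 * ((r v j - r w j) - (r v z - r w z)))"
      by (rule sum.swap)
    also have "\<dots> = (\<Sum>z\<in>V. d z / 2 * ((\<Sum>w\<in>neighbours E v. r v j - r w j) -
        (\<Sum>w\<in>neighbours E v. r v z - r w z)))"
      by (simp only: sum_distrib_left[symmetric] sum_subtractf)
    \<comment> \<open>The value \<open>g v\<close> cancels between the two Laplacians. The first has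
      no point mass because \<open>v\<close> differs from \<open>j\<close>; the second leaves
      \<open>d z / 2 * 2\<close> at \<open>z = v\<close>.\<close>
    also have "\<dots> = (\<Sum>z\<in>V. if v = z then d z else 0)"
      using that by (intro sum.cong refl) (simp add: laplace)
    also have "\<dots> = real (vdegree E v)"
      using that finite_verts by (simp add: d_def)
    finally show ?thesis .
  qed
  have "kemeny V E i = (\<Sum>j\<in>V. ennreal (d j / (2 * m) * h j i))"
    unfolding kemeny_def
  proof (rule sum.cong[OF refl])
    fix j assume j: "j \<in> V"
    have "mean_hitting_time V E i j = ennreal (h j i)" "0 \<le> h j i"
      using mean_hitting_time_eqI[OF hj lap i, of j] j by auto
    then show "ennreal (stationary E j) * mean_hitting_time V E i j = ennreal (d j / (2 * m) * h j i)"
      by (simp add: stationary_def d_def m_def ennreal_mult del: times_divide_eq_left)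
  qed
  also have "\<dots> = ennreal (\<Sum>j\<in>V. d j / (2 * m) * h j i)"
  proof (rule sum_ennreal)
    show "0 \<le> d j / (2 * m) * h j i" if "j \<in> V" for j
      using mean_hitting_time_eqI(2)[OF hj lap i, of j] that by (simp add: d_def m_def)
  qed
  also have "(\<Sum>j\<in>V. d j / (2 * m) * h j i) = (\<Sum>j\<in>V. d j * (2 * h j i)) / (4 * m)"
    by (simp add: sum_divide_distrib)
  also have "(\<Sum>j\<in>V. d j * (2 * h j i)) =
      (\<Sum>j\<in>V. \<Sum>z\<in>V. d j * d z * r i j) + (\<Sum>j\<in>V. \<Sum>z\<in>V. d j * d z * r j z) -
      (\<Sum>j\<in>V. \<Sum>z\<in>V. d j * d z * r i z)"
    unfolding h2 sum.distrib[symmetric] sum_subtractf[symmetric]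
    by (intro sum.cong refl) (simp add: sum_distrib_left algebra_simps sum.distrib sum_subtractf)
  \<comment> \<open>Exchanging the summation indices identifies the two double sums based at
    \<open>i\<close>, so they cancel and only \<open>r j z\<close> survives.\<close>
  also have "(\<Sum>j\<in>V. \<Sum>z\<in>V. d j * d z * r i z) = (\<Sum>j\<in>V. \<Sum>z\<in>V. d j * d z * r i j)"
    by (subst sum.swap) (simp add: mult.commute)
  finally show ?thesis
    by (simp add: d_def m_def)
qed

end


section \<open>The barbell graph\<close>

lemma doubleton_in_clique_edges: "{u, v} \<in> clique_edges S \<longleftrightarrow> u \<in> S \<and> v \<in> S \<and> u \<noteq> v"
  by (auto simp: clique_edges_def doubleton_eq_iff)

lemma card_clique_edges:
  assumes "finite S"
  shows "card (clique_edges S) = card S choose 2"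
proof -
  have "clique_edges S = {T. T \<subseteq> S \<and> card T = 2}"
    by (auto simp: clique_edges_def card_2_iff)
  then show ?thesis
    using n_subsets[OF assms] by simp
qed

lemma finite_clique_edges: "finite S \<Longrightarrow> finite (clique_edges S)"
  by (rule finite_subset[of _ "Pow S"]) (auto simp: clique_edges_def)

lemma real_choose_two: "real (Suc n choose 2) = real n * (real n + 1) / 2"
  by (induction n) (auto simp: numeral_2_eq_2 field_simps)

text \<open>Every clique edge contains a vertex \<open>LeftV\<close> or \<open>RightV\<close>, so
  the three families of edges are disjoint, even for \<open>a = 1\<close>, when the cliques share a
  vertex.\<close>

lemma card_barbell_edges:
  assumes "a \<ge> 1"
  shows "card (barbell_edges a b c) = (a - 1) + ((b + 1) choose 2) + ((c + 1) choose 2)"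
proof -
  let ?P = "{{PathV k, PathV (Suc k)} | k. 1 \<le> k \<and> k < a}"
  let ?L = "insert (PathV 1) (LeftV ` {1..b})" and ?R = "insert (PathV a) (RightV ` {1..c})"
  have P: "?P = (\<lambda>k. {PathV k, PathV (Suc k)}) ` {1..<a}"
    by auto
  have "inj_on (\<lambda>k. {PathV k, PathV (Suc k)}) {1..<a}"
    by (auto simp: inj_on_def doubleton_eq_iff)
  then have cP: "card ?P = a - 1"
    unfolding P by (simp add: card_image)
  have cL: "card ?L = b + 1" and cR: "card ?R = c + 1"
    by (auto simp: card_insert_if card_image inj_on_def)
  have "?P \<inter> clique_edges ?L = {}" "(?P \<union> clique_edges ?L) \<inter> clique_edges ?R = {}"
    by (auto simp: clique_edges_def doubleton_eq_iff)
  moreover have "finite ?P" unfolding P by simp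
  ultimately show ?thesis
    unfolding barbell_edges_def
    by (simp add: card_Un_disjoint finite_clique_edges card_clique_edges cP[simplified] cL[simplified] cR[simplified])
qed

text \<open>Here \<open>\<beta> = 2 / (b + 1)\<close> and \<open>\<gamma> = 2 / (c + 1)\<close> are the resistances across an edge of the two
  cliques.\<close>

fun barbell_resistance :: "nat \<Rightarrow> real \<Rightarrow> real \<Rightarrow> barbell_vertex \<Rightarrow> barbell_vertex \<Rightarrow> real" where
  "barbell_resistance a \<beta> \<gamma> (PathV k) (PathV l) = \<bar>real k - real l\<bar>"
| "barbell_resistance a \<beta> \<gamma> (PathV k) (LeftV l) = real k - 1 + \<beta>"
| "barbell_resistance a \<beta> \<gamma> (PathV k) (RightV l) = real a - real k + \<gamma>"
| "barbell_resistance a \<beta> \<gamma> (LeftV k) (PathV l) = real l - 1 + \<beta>"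
| "barbell_resistance a \<beta> \<gamma> (LeftV k) (LeftV l) = \<beta> - (if k = l then \<beta> else 0)"
| "barbell_resistance a \<beta> \<gamma> (LeftV k) (RightV l) = real a - 1 + \<beta> + \<gamma>"
| "barbell_resistance a \<beta> \<gamma> (RightV k) (PathV l) = real a - real l + \<gamma>"
| "barbell_resistance a \<beta> \<gamma> (RightV k) (LeftV l) = real a - 1 + \<beta> + \<gamma>"
| "barbell_resistance a \<beta> \<gamma> (RightV k) (RightV l) = \<gamma> - (if k = l then \<gamma> else 0)"

lemma barbell_resistance_commute: "barbell_resistance a \<beta> \<gamma> x y = barbell_resistance a \<beta> \<gamma> y x"
  by (cases x; cases y) auto

lemma barbell_resistance_diag: "barbell_resistance a \<beta> \<gamma> x x = 0"
  by (cases x) auto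

text \<open>Taking \<open>y = x\<close> in the Laplacian identity forces \<open>g x\<close> to be 2
  minus the total resistance across the edges at \<open>x\<close>, which is twice the resistance
  curvature. With \<open>(b + 1) * \<beta> = 2\<close>, the \<open>b\<close> clique edges at
  \<open>PathV 1\<close> contribute \<open>b * \<beta> = 2 - \<beta>\<close>, and a vertex
  \<open>LeftV l\<close> is left with \<open>2 - b * \<beta> = \<beta>\<close>.\<close>

fun barbell_curvature :: "nat \<Rightarrow> real \<Rightarrow> real \<Rightarrow> barbell_vertex \<Rightarrow> real" where
  "barbell_curvature a \<beta> \<gamma> (PathV k) = 2 - (if 1 < k then 1 else 0) - (if k < a then 1 else 0) -
     (if k = 1 then 2 - \<beta> else 0) - (if k = a then 2 - \<gamma> else 0)"
| "barbell_curvature a \<beta> \<gamma> (LeftV l) = \<beta>"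
| "barbell_curvature a \<beta> \<gamma> (RightV l) = \<gamma>"

section \<open>Sums over the edges of a path\<close>

lemma sum_abs_diff_path:
  assumes "1 \<le> k" "k \<le> a"
  shows "(\<Sum>l=1..<a. \<bar>real k - real l\<bar> + \<bar>real k - real (Suc l)\<bar>) = (real k - 1)\<^sup>2 + (real a - real k)\<^sup>2"
  using assms(2)
proof (induction a rule: dec_induct)
  case base
  \<comment> \<open>Left of \<open>k\<close> each summand equals
    \<open>(k - l)^2 - (k - l - 1)^2\<close>, so the sum telescopes; \<open>n = k\<close> collects
    all edges on that side.\<close>
  have "(\<Sum>l=1..<n. \<bar>real k - real l\<bar> + \<bar>real k - real (Suc l)\<bar>) =
      (real k - 1)\<^sup>2 - (real k - real n)\<^sup>2" if "1 \<le> n" "n \<le> k" for n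
    using that
    by (induction n rule: dec_induct) (auto simp: power2_eq_square algebra_simps)
  from this[of k] assms(1) show ?case by simp
next
  case (step n)
  then show ?case
    using assms(1) by (simp add: power2_eq_square algebra_simps)
qed

text \<open>Summing over both ends of every edge weights a vertex with its degree in the path. The
  shift to \<open>k - 1\<close> starts the path at 0, which makes the closed form a polynomial in
  the length \<open>a - 1\<close>.\<close>

lemma sum_quadratic_path:
  fixes p q s :: real
  assumes "1 \<le> a"
  shows "(\<Sum>k=1..<a. (p * (real k - 1)\<^sup>2 + q * (real k - 1) + s) +
      (p * (real (Suc k) - 1)\<^sup>2 + q * (real (Suc k) - 1) + s)) =
    p * ((real a - 1) * (2 * (real a - 1)\<^sup>2 + 1) / 3) + q * (real a - 1)\<^sup>2 + 2 * s * (real a - 1)"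
  using assms
  by (induction a rule: dec_induct) (auto simp: power2_eq_square field_simps)

section \<open>Neighbourhoods in the barbell graph and sums over them\<close>

context
  fixes a b c :: nat
  assumes pos: "a \<ge> 1" "b \<ge> 1" "c \<ge> 1"
begin

text \<open>The four conditions are imposed independently, which also covers \<open>a = 1\<close>,
  where a single path vertex carries both cliques.\<close>

lemma neighbours_PathV:
  assumes "1 \<le> k" "k \<le> a"
  shows "neighbours (barbell_edges a b c) (PathV k) =
    (if 1 < k then {PathV (k - 1)} else {}) \<union> (if k < a then {PathV (Suc k)} else {}) \<union>
    (if k = 1 then LeftV ` {1..b} else {}) \<union> (if k = a then RightV ` {1..c} else {})"
proof (rule set_eqI)
  fix w
  have path: "(\<exists>l. {PathV k, w} = {PathV l, PathV (Suc l)} \<and> 1 \<le> l \<and> l < a) \<longleftrightarrow>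
      1 < k \<and> w = PathV (k - 1) \<or> k < a \<and> w = PathV (Suc k)" (is "?L \<longleftrightarrow> ?R")
  proof
    assume ?L
    then show ?R by (auto simp: doubleton_eq_iff)
  next
    assume ?R
    then show ?L
    proof
      assume "1 < k \<and> w = PathV (k - 1)"
      then show ?L using assms by (intro exI[of _ "k - 1"]) auto
    next
      assume "k < a \<and> w = PathV (Suc k)"
      then show ?L using assms by (intro exI[of _ k]) auto
    qed
  qed
  show "w \<in> neighbours (barbell_edges a b c) (PathV k) \<longleftrightarrow> w \<in>
    (if 1 < k then {PathV (k - 1)} else {}) \<union> (if k < a then {PathV (Suc k)} else {}) \<union>
    (if k = 1 then LeftV ` {1..b} else {}) \<union> (if k = a then RightV ` {1..c} else {})"
    unfolding neighbours_def barbell_edges_def mem_Collect_eq Un_iff path doubleton_in_clique_edges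
    using assms by (cases w) auto
qed

lemma neighbours_LeftV:
  assumes "l \<in> {1..b}"
  shows "neighbours (barbell_edges a b c) (LeftV l) = insert (PathV 1) (LeftV ` ({1..b} - {l}))"
  using assms
  by (auto simp: neighbours_def barbell_edges_def doubleton_in_clique_edges doubleton_eq_iff)

lemma neighbours_RightV:
  assumes "l \<in> {1..c}"
  shows "neighbours (barbell_edges a b c) (RightV l) = insert (PathV a) (RightV ` ({1..c} - {l}))"
  using assms
  by (auto simp: neighbours_def barbell_edges_def doubleton_in_clique_edges doubleton_eq_iff)

lemma sum_neighbours_PathV:
  fixes f :: "barbell_vertex \<Rightarrow> real"
  assumes "1 \<le> k" "k \<le> a"
  shows "(\<Sum>w\<in>neighbours (barbell_edges a b c) (PathV k). f w) =
    (if 1 < k then f (PathV (k - 1)) else 0) + (if k < a then f (PathV (Suc k)) else 0) +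
    (if k = 1 then \<Sum>l=1..b. f (LeftV l) else 0) + (if k = a then \<Sum>l=1..c. f (RightV l) else 0)"
proof -
  have "(\<Sum>w\<in>LeftV ` {1..b}. f w) = (\<Sum>l=1..b. f (LeftV l))"
    "(\<Sum>w\<in>RightV ` {1..c}. f w) = (\<Sum>l=1..c. f (RightV l))"
    by (simp_all add: sum.reindex inj_on_def)
  moreover have "(\<Sum>w\<in>neighbours (barbell_edges a b c) (PathV k). f w) =
    (\<Sum>w\<in>(if 1 < k then {PathV (k - 1)} else {}). f w) +
    (\<Sum>w\<in>(if k < a then {PathV (Suc k)} else {}). f w) +
    (\<Sum>w\<in>(if k = 1 then LeftV ` {1..b} else {}). f w) +
    (\<Sum>w\<in>(if k = a then RightV ` {1..c} else {}). f w)"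
    unfolding neighbours_PathV[OF assms]
    by (subst sum.union_disjoint, simp, simp, force)+ simp
  ultimately show ?thesis by (simp only: if_distrib[of "sum f"] sum.insert sum.empty finite.emptyI empty_iff simp_thms add_0_right)
qed

lemma sum_neighbours_LeftV:
  fixes f :: "barbell_vertex \<Rightarrow> real"
  assumes "l \<in> {1..b}"
  shows "(\<Sum>w\<in>neighbours (barbell_edges a b c) (LeftV l). f w) =
    f (PathV 1) + (\<Sum>k=1..b. f (LeftV k)) - f (LeftV l)"
proof -
  have "(\<Sum>w\<in>neighbours (barbell_edges a b c) (LeftV l). f w) =
      f (PathV 1) + (\<Sum>w\<in>LeftV ` ({1..b} - {l}). f w)"
    unfolding neighbours_LeftV[OF assms] by (subst sum.insert) auto
  also have "(\<Sum>w\<in>LeftV ` ({1..b} - {l}). f w) = (\<Sum>k\<in>{1..b} - {l}. f (LeftV k))"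
    by (simp add: sum.reindex inj_on_def)
  finally show ?thesis
    using assms by (simp add: sum_diff1)
qed

lemma sum_neighbours_RightV:
  fixes f :: "barbell_vertex \<Rightarrow> real"
  assumes "l \<in> {1..c}"
  shows "(\<Sum>w\<in>neighbours (barbell_edges a b c) (RightV l). f w) =
    f (PathV a) + (\<Sum>k=1..c. f (RightV k)) - f (RightV l)"
proof -
  have "(\<Sum>w\<in>neighbours (barbell_edges a b c) (RightV l). f w) =
      f (PathV a) + (\<Sum>w\<in>RightV ` ({1..c} - {l}). f w)"
    unfolding neighbours_RightV[OF assms] by (subst sum.insert) auto
  also have "(\<Sum>w\<in>RightV ` ({1..c} - {l}). f w) = (\<Sum>k\<in>{1..c} - {l}. f (RightV k))"
    by (simp add: sum.reindex inj_on_def)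
  finally show ?thesis
    using assms by (simp add: sum_diff1)
qed

lemma barbell_cases:
  assumes "x \<in> barbell_verts a b c"
  obtains (Path) k where "x = PathV k" "1 \<le> k" "k \<le> a"
  | (Left) l where "x = LeftV l" "l \<in> {1..b}"
  | (Right) l where "x = RightV l" "l \<in> {1..c}"
  using assms by (auto simp: barbell_verts_def)

lemma walkable_barbell: "walkable_graph (barbell_verts a b c) (barbell_edges a b c)"
proof
  show "finite (barbell_verts a b c)"
    by (simp add: barbell_verts_def)
  show "e \<subseteq> barbell_verts a b c" if "e \<in> barbell_edges a b c" for e
    using that pos by (auto simp: barbell_edges_def barbell_verts_def clique_edges_def)
  show "neighbours (barbell_edges a b c) v \<noteq> {}" if "v \<in> barbell_verts a b c" for v
    using that
  proof (cases rule: barbell_cases)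
    case (Path k)
    then show ?thesis using pos by (auto simp: neighbours_PathV)
  qed (simp_all add: neighbours_LeftV neighbours_RightV)
qed

text \<open>A degree-weighted sum adds \<open>f\<close> at both ends of every edge. Keeping the path
  edges as pairs avoids distinguishing the ends of the path from its interior.\<close>

lemma sum_vdegree_barbell:
  fixes f :: "barbell_vertex \<Rightarrow> real"
  shows "(\<Sum>x\<in>barbell_verts a b c. real (vdegree (barbell_edges a b c) x) * f x) =
    (\<Sum>k=1..<a. f (PathV k) + f (PathV (Suc k))) + real b * f (PathV 1) + real c * f (PathV a) +
    real b * (\<Sum>l=1..b. f (LeftV l)) + real c * (\<Sum>l=1..c. f (RightV l))"
proof -
  let ?d = "\<lambda>x. real (vdegree (barbell_edges a b c) x)"
  have d: "?d x = (\<Sum>w\<in>neighbours (barbell_edges a b c) x. 1)" for x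
    by (simp add: vdegree_def)
  have dL: "?d (LeftV l) = b" if "l \<in> {1..b}" for l
    unfolding d sum_neighbours_LeftV[OF that] by simp
  have dR: "?d (RightV l) = c" if "l \<in> {1..c}" for l
    unfolding d sum_neighbours_RightV[OF that] by simp
  \<comment> \<open>The two interval conditions stand for the edges to the left and to the right of
    \<open>PathV k\<close>; the first interval is the second one shifted by 1, ready for
    reindexing.\<close>
  have dP: "?d (PathV k) * f (PathV k) =
      (if k \<in> {Suc 1..<Suc a} then f (PathV k) else 0) + (if k \<in> {1..<a} then f (PathV k) else 0) +
      (if k = 1 then b * f (PathV 1) else 0) + (if k = a then c * f (PathV a) else 0)"
    if "k \<in> {1..a}" for k
    using that unfolding d by (subst sum_neighbours_PathV) (auto simp: algebra_simps)
  have int: "{1..a} \<inter> {Suc 1..<Suc a} = {Suc 1..<Suc a}" "{1..a} \<inter> {1..<a} = {1..<a}"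
    by auto
  have "(\<Sum>k=1..a. ?d (PathV k) * f (PathV k)) = (\<Sum>k=1..a.
      (if k \<in> {Suc 1..<Suc a} then f (PathV k) else 0) + (if k \<in> {1..<a} then f (PathV k) else 0) +
      (if k = 1 then b * f (PathV 1) else 0) + (if k = a then c * f (PathV a) else 0))"
    by (rule sum.cong[OF refl dP])
  also have "\<dots> =
      (\<Sum>k\<in>{Suc 1..<Suc a}. f (PathV k)) + (\<Sum>k=1..<a. f (PathV k)) + b * f (PathV 1) + c * f (PathV a)"
    using pos
    by (simp only: sum.distrib sum.inter_restrict[symmetric] finite_atLeastAtMost int)
      simp
  also have "(\<Sum>k\<in>{Suc 1..<Suc a}. f (PathV k)) = (\<Sum>k=1..<a. f (PathV (Suc k)))"
    by (rule sum.shift_bounds_Suc_ivl)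
  finally have P: "(\<Sum>k=1..a. ?d (PathV k) * f (PathV k)) =
      (\<Sum>k=1..<a. f (PathV k) + f (PathV (Suc k))) + b * f (PathV 1) + c * f (PathV a)"
    by (simp add: sum.distrib)
  have "(\<Sum>x\<in>barbell_verts a b c. ?d x * f x) =
      (\<Sum>k=1..a. ?d (PathV k) * f (PathV k)) + (\<Sum>l=1..b. ?d (LeftV l) * f (LeftV l)) +
      (\<Sum>l=1..c. ?d (RightV l) * f (RightV l))"
    unfolding barbell_verts_def
    by (subst sum.union_disjoint, simp, simp, force)+ (simp add: sum.reindex inj_on_def)
  then show ?thesis
    unfolding P by (simp add: dL dR sum_distrib_left)
qed

section \<open>The Laplacian of the resistance function\<close>

lemma resistance_diff_LeftV:
  assumes "y \<in> barbell_verts a b c"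
  shows "barbell_resistance a \<beta> \<gamma> (PathV 1) y - barbell_resistance a \<beta> \<gamma> (LeftV l) y =
    (if y = LeftV l then \<beta> else 0) - (if y \<in> range LeftV then 0 else \<beta>)"
  \<comment> \<open>For \<open>y\<close> outside the left clique vertices, \<open>LeftV l\<close>
    lies \<beta> further away than the cut vertex \<open>PathV 1\<close>. Any other
    \<open>LeftV\<close> vertex is at resistance \<beta> from both.\<close>
  using assms by (cases rule: barbell_cases) auto

text \<open>Outside the left clique vertices all \<open>b\<close> terms are -\<beta>, with
  \<open>b * \<beta> = 2 - \<beta>\<close>. Inside, only the term at \<open>y\<close> survives, and
  its value \<beta> is written so that the part \<open>2 - \<beta>\<close> is common to both
  cases.\<close>

lemma sum_resistance_diff_LeftV:
  assumes "(real b + 1) * \<beta> = 2" and y: "y \<in> barbell_verts a b c"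
  shows "(\<Sum>l=1..b. barbell_resistance a \<beta> \<gamma> (PathV 1) y - barbell_resistance a \<beta> \<gamma> (LeftV l) y) =
    (if y \<in> range LeftV then 2 else 0) - (2 - \<beta>)"
proof (cases "y \<in> range LeftV")
  case True
  then obtain q where "y = LeftV q" "q \<in> {1..b}"
    using y by (auto simp: barbell_verts_def)
  with True show ?thesis
    unfolding resistance_diff_LeftV[OF y] by simp
next
  case False
  then have "y \<noteq> LeftV l" for l by blast
  with False assms(1) show ?thesis
    unfolding resistance_diff_LeftV[OF y] by (simp add: algebra_simps)
qed

lemma resistance_diff_RightV:
  assumes "y \<in> barbell_verts a b c"
  shows "barbell_resistance a \<beta> \<gamma> (PathV a) y - barbell_resistance a \<beta> \<gamma> (RightV l) y =
    (if y = RightV l then \<gamma> else 0) - (if y \<in> range RightV then 0 else \<gamma>)"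
  using assms by (cases rule: barbell_cases) auto

lemma sum_resistance_diff_RightV:
  assumes "(real c + 1) * \<gamma> = 2" and y: "y \<in> barbell_verts a b c"
  shows "(\<Sum>l=1..c. barbell_resistance a \<beta> \<gamma> (PathV a) y - barbell_resistance a \<beta> \<gamma> (RightV l) y) =
    (if y \<in> range RightV then 2 else 0) - (2 - \<gamma>)"
proof (cases "y \<in> range RightV")
  case True
  then obtain q where "y = RightV q" "q \<in> {1..c}"
    using y by (auto simp: barbell_verts_def)
  with True show ?thesis
    unfolding resistance_diff_RightV[OF y] by simp
next
  case False
  then have "y \<noteq> RightV l" for l by blast
  with False assms(1) show ?thesis
    unfolding resistance_diff_RightV[OF y] by (simp add: algebra_simps)
qed

text \<open>This verifies the Laplacian hypothesis of \<open>kemeny_eq_resistance\<close> for the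
  explicit resistances.\<close>

lemma sum_neighbours_barbell_resistance:
  assumes \<beta>: "(real b + 1) * \<beta> = 2" and \<gamma>: "(real c + 1) * \<gamma> = 2"
    and x: "x \<in> barbell_verts a b c" and y: "y \<in> barbell_verts a b c"
  shows "(\<Sum>w\<in>neighbours (barbell_edges a b c) x.
      barbell_resistance a \<beta> \<gamma> x y - barbell_resistance a \<beta> \<gamma> w y) =
    barbell_curvature a \<beta> \<gamma> x - (if x = y then 2 else 0)"
proof -
  let ?r = "barbell_resistance a \<beta> \<gamma>"
  show ?thesis
    using x
  proof (cases rule: barbell_cases)
    case (Path k)
    have k: "1 \<le> k" "k \<le> a" by fact+
    \<comment> \<open>\<open>PathV p\<close> is the path vertex nearest to \<open>y\<close>;
      resistance differences along the path depend on \<open>y\<close> only through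
      \<open>p\<close>.\<close>
    define p where "p = (case y of PathV l \<Rightarrow> l | LeftV _ \<Rightarrow> 1 | RightV _ \<Rightarrow> a)"
    have p: "1 \<le> p" "p \<le> a"
      using y pos by (auto simp: p_def barbell_verts_def)
    have down: "(if 1 < k then ?r (PathV k) y - ?r (PathV (k - 1)) y else 0) =
        (if p < k then 2 else 0) - (if 1 < k then 1 else 0)"
      using k p by (cases y) (auto simp: p_def)
    have up: "(if k < a then ?r (PathV k) y - ?r (PathV (Suc k)) y else 0) =
        (if k < p then 2 else 0) - (if k < a then 1 else 0)"
      using k p by (cases y) (auto simp: p_def)
    have left: "(if k = 1 then \<Sum>l=1..b. ?r (PathV k) y - ?r (LeftV l) y else 0) =
        (if k = 1 \<and> y \<in> range LeftV then 2 else 0) - (if k = 1 then 2 - \<beta> else 0)"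
      using sum_resistance_diff_LeftV[OF \<beta> y] by simp
    have right: "(if k = a then \<Sum>l=1..c. ?r (PathV k) y - ?r (RightV l) y else 0) =
        (if k = a \<and> y \<in> range RightV then 2 else 0) - (if k = a then 2 - \<gamma> else 0)"
      using sum_resistance_diff_RightV[OF \<gamma> y] by simp
    \<comment> \<open>Exactly one of \<open>p < k\<close>, \<open>k < p\<close>,
      \<open>k = p\<close> holds, so \<open>down\<close> and \<open>up\<close> together contribute
      \<open>2 - (if k = p then 2 else 0)\<close>.\<close>
    have "(\<Sum>w\<in>neighbours (barbell_edges a b c) x. ?r x y - ?r w y) =
        barbell_curvature a \<beta> \<gamma> x - (if k = p then 2 else 0) +
        (if k = 1 \<and> y \<in> range LeftV then 2 else 0) + (if k = a \<and> y \<in> range RightV then 2 else 0)"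
      unfolding \<open>x = PathV k\<close> sum_neighbours_PathV[OF k] down up left right barbell_curvature.simps
      by (cases k p rule: linorder_cases) simp_all
    \<comment> \<open>If \<open>y\<close> lies in a clique off the path, the clique term cancels the
      point mass at \<open>k = p\<close>; it remains only for \<open>y = PathV k\<close>.\<close>
    also have "\<dots> = barbell_curvature a \<beta> \<gamma> x - (if x = y then 2 else 0)"
      using y unfolding \<open>x = PathV k\<close> by (cases rule: barbell_cases) (auto simp: p_def)
    finally show ?thesis .
  next
    case (Left k)
    \<comment> \<open>Differences are measured from the hub \<open>PathV 1\<close>: a clique
      neighbour contributes \<open>?D l - ?D k\<close>, and the hub itself contributes
      \<open>- ?D k\<close>.\<close>
    let ?D = "\<lambda>l. ?r (PathV 1) y - ?r (LeftV l) y"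
    have "(\<Sum>w\<in>neighbours (barbell_edges a b c) x. ?r x y - ?r w y) = (\<Sum>l=1..b. ?D l - ?D k) - ?D k"
      unfolding \<open>x = LeftV k\<close> sum_neighbours_LeftV[OF Left(2)] by simp
    also have "\<dots> = (\<Sum>l=1..b. ?D l) - (real b + 1) * ?D k"
      by (simp only: sum_subtractf) (simp add: algebra_simps)
    also have "\<dots> = barbell_curvature a \<beta> \<gamma> x - (if x = y then 2 else 0)"
      unfolding sum_resistance_diff_LeftV[OF \<beta> y] unfolding resistance_diff_LeftV[OF y] right_diff_distrib
      using \<beta> \<open>x = LeftV k\<close> by auto
    finally show ?thesis .
  next
    case (Right k)
    let ?D = "\<lambda>l. ?r (PathV a) y - ?r (RightV l) y"
    have "(\<Sum>w\<in>neighbours (barbell_edges a b c) x. ?r x y - ?r w y) = (\<Sum>l=1..c. ?D l - ?D k) - ?D k"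
      unfolding \<open>x = RightV k\<close> sum_neighbours_RightV[OF Right(2)] by simp
    also have "\<dots> = (\<Sum>l=1..c. ?D l) - (real c + 1) * ?D k"
      by (simp only: sum_subtractf) (simp add: algebra_simps)
    also have "\<dots> = barbell_curvature a \<beta> \<gamma> x - (if x = y then 2 else 0)"
      unfolding sum_resistance_diff_RightV[OF \<gamma> y] unfolding resistance_diff_RightV[OF y] right_diff_distrib
      using \<gamma> \<open>x = RightV k\<close> by auto
    finally show ?thesis .
  qed
qed

section \<open>Evaluation of the degree-weighted resistance sum\<close>

lemma sum_vdegree_resistance:
  fixes \<beta> \<gamma> :: real
  defines "A \<equiv> real a - 1" and "B \<equiv> real b" and "C \<equiv> real c"
  shows "(\<Sum>x\<in>barbell_verts a b c. \<Sum>y\<in>barbell_verts a b c.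
      real (vdegree (barbell_edges a b c) x) * real (vdegree (barbell_edges a b c) y) *
      barbell_resistance a \<beta> \<gamma> x y) =
    2 * (A * (2 * A\<^sup>2 + 1) / 3) + 2 * (B + B\<^sup>2 + C + C\<^sup>2) * A\<^sup>2 + 2 * (B + B\<^sup>2) * (C + C\<^sup>2) * A +
    4 * A * (B\<^sup>2 * \<beta> + C\<^sup>2 * \<gamma>) + 2 * (C + C\<^sup>2) * B\<^sup>2 * \<beta> + 2 * (B + B\<^sup>2) * C\<^sup>2 * \<gamma> +
    B ^ 3 * (B + 1) * \<beta> + C ^ 3 * (C + 1) * \<gamma>"
proof -
  let ?r = "barbell_resistance a \<beta> \<gamma>" and ?d = "\<lambda>x. real (vdegree (barbell_edges a b c) x)"
  \<comment> \<open>The double sum is evaluated by applying \<open>sum_vdegree_barbell\<close>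
    twice, first to the inner sum \<open>R x\<close> and then to \<open>R\<close>.\<close>
  define R where "R x = (\<Sum>y\<in>barbell_verts a b c. ?d y * ?r x y)" for x
  \<comment> \<open>On the path \<open>R\<close> is quadratic in \<open>k - 1\<close>, with leading
    coefficient 2, linear coefficient \<open>?q\<close> and value \<open>?s\<close> at
    \<open>PathV 1\<close>.\<close>
  let ?s = "A\<^sup>2 + (C + C\<^sup>2) * A + B\<^sup>2 * \<beta> + C\<^sup>2 * \<gamma>"
  let ?q = "B + B\<^sup>2 - C - C\<^sup>2 - 2 * A"
  have RP: "R (PathV k) = 2 * (real k - 1)\<^sup>2 + ?q * (real k - 1) + ?s" if "1 \<le> k" "k \<le> a" for k
    unfolding R_def sum_vdegree_barbell barbell_resistance.simps sum_abs_diff_path[OF that]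
    using that by (simp add: A_def B_def C_def power2_eq_square algebra_simps)
  have RL: "R (LeftV l) = A\<^sup>2 + 2 * A * \<beta> + C * (A + \<beta>) + B\<^sup>2 * \<beta> + C\<^sup>2 * (A + \<beta> + \<gamma>)" if "l \<in> {1..b}" for l
  proof -
    have path: "(\<Sum>k=1..<a. (real k - 1 + \<beta>) + (real (Suc k) - 1 + \<beta>)) = A\<^sup>2 + 2 * A * \<beta>"
      using sum_quadratic_path[OF pos(1), of 0 1 \<beta>] by (simp add: A_def)
    have clique: "(\<Sum>k=1..b. \<beta> - (if l = k then \<beta> else 0)) = B * \<beta> - \<beta>"
      using that by (simp add: sum_subtractf B_def)
    show ?thesis
      unfolding R_def sum_vdegree_barbell barbell_resistance.simps path clique
      by (simp add: A_def B_def C_def power2_eq_square algebra_simps)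
  qed
  have RR: "R (RightV l) = A\<^sup>2 + 2 * A * \<gamma> + B * (A + \<gamma>) + C\<^sup>2 * \<gamma> + B\<^sup>2 * (A + \<beta> + \<gamma>)" if "l \<in> {1..c}" for l
  proof -
    \<comment> \<open>The coefficients come from
      \<open>a - k + \<gamma> = (A + \<gamma>) - (k - 1)\<close>.\<close>
    have path: "(\<Sum>k=1..<a. (real a - real k + \<gamma>) + (real a - real (Suc k) + \<gamma>)) = A\<^sup>2 + 2 * A * \<gamma>"
      using sum_quadratic_path[OF pos(1), of 0 "-1" "A + \<gamma>"]
      by (simp add: A_def power2_eq_square algebra_simps)
    have clique: "(\<Sum>k=1..c. \<gamma> - (if l = k then \<gamma> else 0)) = C * \<gamma> - \<gamma>"
      using that by (simp add: sum_subtractf C_def)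
    show ?thesis
      unfolding R_def sum_vdegree_barbell barbell_resistance.simps path clique
      by (simp add: A_def B_def C_def power2_eq_square algebra_simps)
  qed
  have "(\<Sum>x\<in>barbell_verts a b c. \<Sum>y\<in>barbell_verts a b c. ?d x * ?d y * ?r x y) =
      (\<Sum>x\<in>barbell_verts a b c. ?d x * R x)"
    by (simp add: R_def sum_distrib_left mult.assoc)
  also have "\<dots> = (\<Sum>k=1..<a. R (PathV k) + R (PathV (Suc k))) + B * R (PathV 1) + C * R (PathV a) +
      B * (\<Sum>l=1..b. R (LeftV l)) + C * (\<Sum>l=1..c. R (RightV l))"
    unfolding sum_vdegree_barbell B_def C_def ..
  also have "(\<Sum>k=1..<a. R (PathV k) + R (PathV (Suc k))) =
      (\<Sum>k=1..<a. (2 * (real k - 1)\<^sup>2 + ?q * (real k - 1) + ?s) +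
        (2 * (real (Suc k) - 1)\<^sup>2 + ?q * (real (Suc k) - 1) + ?s))"
    by (intro sum.cong) (simp_all add: RP)
  also have "\<dots> = 2 * (A * (2 * A\<^sup>2 + 1) / 3) + ?q * A\<^sup>2 + 2 * ?s * A"
    unfolding A_def by (rule sum_quadratic_path[OF pos(1)])
  also have "(\<Sum>l=1..b. R (LeftV l)) =
      B * (A\<^sup>2 + 2 * A * \<beta> + C * (A + \<beta>) + B\<^sup>2 * \<beta> + C\<^sup>2 * (A + \<beta> + \<gamma>))"
    by (simp add: RL B_def)
  also have "(\<Sum>l=1..c. R (RightV l)) =
      C * (A\<^sup>2 + 2 * A * \<gamma> + B * (A + \<gamma>) + C\<^sup>2 * \<gamma> + B\<^sup>2 * (A + \<beta> + \<gamma>))"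
    by (simp add: RR C_def)
  also have "R (PathV 1) = ?s"
    using pos by (simp add: RP)
  also have "R (PathV a) = 2 * A\<^sup>2 + ?q * A + ?s"
    using pos by (simp add: RP A_def)
  finally show ?thesis
    by (simp add: power2_eq_square power3_eq_cube algebra_simps)
qed

end

section \<open>Kemeny's constant of the barbell graph\<close>

theorem theorem3p4:
  fixes a b c :: nat and m :: real and i :: barbell_vertex
  assumes "a \<ge> 1" and "b \<ge> 1" and "c \<ge> 1"
    and "m = real ((b + 1) choose 2) + real ((c + 1) choose 2) + real a - 1"
    and "i \<in> barbell_verts a b c"
  shows "kemeny (barbell_verts a b c) (barbell_edges a b c) i =
    ennreal (1 / m *
      (real ((b + 1) choose 2) *
         (real b ^ 2 / (real b + 1) + (real a - 1) ^ 2 + 2 * real c ^ 2 / (real c + 1))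
       + (real a - 1) *
         ((2 * real a ^ 2 - 4 * real a + 3) / 6
          + 2 * real b ^ 2 / (real b + 1) + 2 * real c ^ 2 / (real c + 1))
       + real ((c + 1) choose 2) *
         (real c ^ 2 / (real c + 1) + (real a - 1) ^ 2 + 2 * real b ^ 2 / (real b + 1))
       + 2 * real ((b + 1) choose 2) * real ((c + 1) choose 2) * (real a - 1)))"
    (is "_ = ennreal (1 / m * ?X)")
proof -
  define A B C where "A = real a - 1" and "B = real b" and "C = real c"
  define \<beta> \<gamma> where "\<beta> = 2 / (real b + 1)" and "\<gamma> = 2 / (real c + 1)"
  let ?V = "barbell_verts a b c" and ?E = "barbell_edges a b c"
  have \<beta>: "(real b + 1) * \<beta> = 2" and \<gamma>: "(real c + 1) * \<gamma> = 2"
    by (simp_all add: \<beta>_def \<gamma>_def field_simps)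
  have m: "real (card ?E) = m"
    using assms(1,4) by (simp add: card_barbell_edges of_nat_diff)
  interpret walkable_graph ?V ?E
    using assms(1-3) by (rule walkable_barbell)
  \<comment> \<open>Expressing the fractions through \<beta> and \<gamma> turns the final comparison
    into a polynomial identity in \<open>A\<close>, \<open>B\<close>, \<open>C\<close>, \<beta> and
    \<gamma>.\<close>
  have quot: "real b ^ 2 / (real b + 1) = B\<^sup>2 * \<beta> / 2" "2 * real b ^ 2 / (real b + 1) = B\<^sup>2 * \<beta>"
    "real c ^ 2 / (real c + 1) = C\<^sup>2 * \<gamma> / 2" "2 * real c ^ 2 / (real c + 1) = C\<^sup>2 * \<gamma>"
    by (simp_all add: B_def C_def \<beta>_def \<gamma>_def field_simps)
  have choose: "real ((b + 1) choose 2) = B * (B + 1) / 2" "real ((c + 1) choose 2) = C * (C + 1) / 2"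
    using real_choose_two[of b] real_choose_two[of c] by (simp_all add: B_def C_def)
  have "real a = A + 1" by (simp add: A_def)
  have "kemeny ?V ?E i = ennreal ((\<Sum>x\<in>?V. \<Sum>y\<in>?V. real (vdegree ?E x) * real (vdegree ?E y) *
      barbell_resistance a \<beta> \<gamma> x y) / (4 * real (card ?E)))"
    using barbell_resistance_commute barbell_resistance_diag
      sum_neighbours_barbell_resistance[OF assms(1-3) \<beta> \<gamma>] assms(5)
    by (rule kemeny_eq_resistance)
  also have "(\<Sum>x\<in>?V. \<Sum>y\<in>?V. real (vdegree ?E x) * real (vdegree ?E y) *
      barbell_resistance a \<beta> \<gamma> x y) = 4 * ?X"
    \<comment> \<open>With \<open>a = A + 1\<close> the path factor
      \<open>2 * a^2 - 4 * a + 3\<close> becomes \<open>2 * A^2 + 1\<close>, matching the sum over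
      pairs of path vertices.\<close>
    unfolding sum_vdegree_resistance[OF assms(1-3)] quot choose
    unfolding A_def[symmetric] B_def[symmetric] C_def[symmetric] \<open>real a = A + 1\<close>
    by (simp add: power2_eq_square power3_eq_cube field_simps)
  also have "4 * ?X / (4 * real (card ?E)) = 1 / m * ?X"
    unfolding m by (simp only: mult_divide_mult_cancel_left_if) simp
  finally show ?thesis .
qed

end
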